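(* Let $q$ be an odd prime power and let $\gamma\in\mathbb{F}_{q^2}$. The polynomial $f(x)=x+\gamma\,\mathrm{Tr}\left(x^{q+1}\right)$ over $\mathbb{F}_{q^2}$ is a permutation polynomial if and only if $\gamma=0$.
   Context: $\mathrm{Tr}:\mathbb{F}_{q^2}\to\mathbb{F}_q$ is the trace map $\mathrm{Tr}(x)=x+x^q$. A polynomial $f$ over $\mathbb{F}_{q^2}$ is a permutation polynomial if the map $x\mapsto f(x)$ is a bijection of $\mathbb{F}_{q^2}$ onto itself. *)

theory Defs
  imports
    "HOL-Computational_Algebra.Computational_Algebra"
    "HOL-Number_Theory.Number_Theory"
    "HOL-Library.Cardinality"
begin

text \<open>
  The field with \<open>q\<^sup>2\<close> elements is a type \<open>'a\<close> of class \<^class>\<open>finite_field\<close> with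
  \<open>CARD('a) = q\<^sup>2\<close>; its subfield with \<open>q\<close> elements is \<open>{x. x ^ q = x}\<close>.

  The trace is defined by the same formula for field elements and for polynomials, so that
  \<open>Tr q p\<close> is the polynomial obtained by substituting a polynomial \<open>p\<close> into
  \<open>X + X ^ q\<close>, where \<open>X\<close> is \<open>[:0, 1:]\<close>.
\<close>

definition Tr :: "nat \<Rightarrow> 'a :: comm_semiring_1 \<Rightarrow> 'a" where
  "Tr q x = x + x ^ q"

lemma poly_Tr: "poly (Tr q p) x = Tr q (poly p x)"
  by (simp add: Tr_def)

lemma Tr_power_eq:
  fixes x :: "'a :: finite_field"
  assumes q: "primepow q" and card: "CARD('a) = q ^ 2"
  shows "Tr q x ^ q = Tr q x"
proof -
  obtain p k where pk: "prime p" "k > 0" "q = p ^ k"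
    using q by (auto simp: primepow_def)
  have char: "prime CHAR('a)"
    by (rule prime_CHAR_semidom) (rule CHAR_pos)
  have "CHAR('a) dvd q ^ 2"
    using CHAR_dvd_CARD[where ?'a = 'a] card by simp
  hence "CHAR('a) = p"
    using char pk by (metis prime_dvd_power primes_dvd_imp_eq)
  hence "Tr q x ^ q = x ^ q + (x ^ q) ^ q"
    unfolding Tr_def using freshmans_dream'[OF char, of q k x "x ^ q"] pk by simp
  also have "(x ^ q) ^ q = x"
    using finite_field_power_card_eq_same[of x] card
    by (simp add: power2_eq_square power_mult)
  finally show ?thesis
    by (simp add: Tr_def add.commute)
qed

definition permutation_polynomial :: "'a :: finite_field poly \<Rightarrow> bool" where
  "permutation_polynomial f \<longleftrightarrow> bij (poly f)"

end

theory Submission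
  imports Defs
begin

text \<open>
  Since \<open>x ^ (q + 1)\<close> lies in the subfield with \<open>q\<close> elements, its trace is \<open>2 * x ^ (q + 1)\<close>, and
  the polynomial acts as \<open>x * (1 + 2 * \<gamma> * x ^ q)\<close>. As \<open>x \<mapsto> x ^ q\<close> is an involution,
  for \<open>\<gamma> \<noteq> 0\<close> the second factor vanishes at \<open>x = (- 1 / (2 * \<gamma>)) ^ q\<close>, so \<open>0\<close> has two preimages.
\<close>

theorem theorem3p3:
  fixes q :: nat and \<gamma> :: "'a :: finite_field"
  assumes "primepow q" and "odd q" and "CARD('a) = q ^ 2"
  shows "permutation_polynomial ([:0, 1:] + Polynomial.smult \<gamma> (Tr q ([:0, 1:] ^ (q + 1)))) \<longleftrightarrow> \<gamma> = 0"
proof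
  let ?f = "[:0, 1:] + Polynomial.smult \<gamma> (Tr q ([:0, 1:] ^ (q + 1)))"
  have f: "poly ?f x = x + \<gamma> * Tr q (x ^ (q + 1))" for x
    by (simp add: poly_Tr)
  \<comment> \<open>In characteristic 2, \<open>CHAR('a)\<close> would divide the odd number
    \<open>q ^ 2\<close>. This makes the division by \<open>2 * \<gamma>\<close> below
    legitimate.\<close>
  have two: "(2 :: 'a) \<noteq> 0"
  proof
    assume "(2 :: 'a) = 0"
    hence "CHAR('a) dvd 2"
      by (metis of_nat_eq_0_iff_char_dvd of_nat_numeral)
    hence "CHAR('a) = 2"
      using CHAR_not_1 two_is_prime_nat by (auto simp: prime_nat_iff)
    hence "even (q ^ 2)"
      using CHAR_dvd_CARD[where ?'a = 'a] assms(3) by simp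
    with assms(2) show False by simp
  qed
  show "\<gamma> = 0" if perm: "permutation_polynomial ?f"
  proof (rule ccontr)
    assume "\<gamma> \<noteq> 0"
    define c where "c = - 1 / (2 * \<gamma>)"
    have "c \<noteq> 0" and c: "\<gamma> * (2 * c) = -1"
      using two \<open>\<gamma> \<noteq> 0\<close> by (simp_all add: c_def)
    have inv: "(c ^ q) ^ q = c"
      using finite_field_power_card_eq_same[of c] assms(3)
      by (simp add: power2_eq_square power_mult)
    \<comment> \<open>By \<open>inv\<close>, \<open>(c ^ q) ^ (q + 1)\<close> is
      \<open>c ^ q * c\<close>, and raising it to the power \<open>q\<close> only swaps the two
      factors.\<close>
    have "Tr q ((c ^ q) ^ (q + 1)) = 2 * c * c ^ q"
      by (simp add: Tr_def power_mult_distrib inv)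
    hence "poly ?f (c ^ q) = c ^ q + \<gamma> * (2 * c) * c ^ q"
      by (simp only: f mult.assoc)
    \<comment> \<open>Both values are 0; at 0 this needs \<open>q > 0\<close>, since
      \<open>0 ^ 0 = 1\<close>.\<close>
    hence "poly ?f (c ^ q) = poly ?f 0"
      using assms(2) odd_pos by (simp add: c f Tr_def)
    hence "c ^ q = 0"
      using perm by (metis permutation_polynomial_def bij_is_inj injD)
    with \<open>c \<noteq> 0\<close> show False by simp
  qed
  show "permutation_polynomial ?f" if "\<gamma> = 0"
    using that by (simp add: permutation_polynomial_def bij_def inj_def surj_def)
qed

end
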